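(* Let $q\ge 0$ be an integer, let $x_0,\dots,x_q\in\mathbb{C}$ and let $\tau\in\mathbb{R}$. Then $$\sum_{j=0}^q e^{-\tau[x_0,\dots,x_q,x_j]}=-\tau\,e^{-\tau[x_0,\dots,x_q]}.$$
   Context: For a number $t$ and nodes $z_0,\dots,z_m\in\mathbb{C}$, $e^{t[z_0,\dots,z_m]}$ denotes the divided difference $f[z_0,\dots,z_m]$ of the function $f(x)=e^{tx}$ at the nodes $z_0,\dots,z_m$ (not the exponential of a divided difference). Here, for holomorphic $f$, $f[z_0,\dots,z_m]=\frac{1}{2\pi i}\oint_\Gamma\frac{f(z)}{\prod_{i=0}^m(z-z_i)}\,dz$ with $\Gamma$ a positively oriented contour enclosing all the $z_i$; for pairwise distinct nodes this equals $\sum_{i=0}^m f(z_i)/\prod_{k\ne i}(z_i-z_k)$. Nodes may be repeated; $[x_0,\dots,x_q,x_j]$ is the list $x_0,\dots,x_q$ with $x_j$ appended once more. *)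

theory Defs
  imports "HOL-Complex_Analysis.Complex_Analysis"
begin

definition enclosing_contour :: "(complex \<Rightarrow> complex) \<Rightarrow> complex set \<Rightarrow> (real \<Rightarrow> complex) \<Rightarrow> bool" where
  "enclosing_contour f Z \<gamma> \<longleftrightarrow>
     valid_path \<gamma> \<and> simple_path \<gamma> \<and> pathfinish \<gamma> = pathstart \<gamma> \<and>
     (\<forall>z\<in>inside (path_image \<gamma>). winding_number \<gamma> z = 1) \<and>
     Z \<subseteq> inside (path_image \<gamma>) \<and>
     (\<exists>S. open S \<and> path_image \<gamma> \<union> inside (path_image \<gamma>) \<subseteq> S \<and> f holomorphic_on S)"

(* The nodes form a list, so that repetitions count.  The choice of the contour
   is immaterial by divided_difference_eq; without an admissible contour the
   value is unspecified. *)
definition divided_difference :: "(complex \<Rightarrow> complex) \<Rightarrow> complex list \<Rightarrow> complex" where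
  "divided_difference f zs =
     1 / (2 * of_real pi * \<i>) *
     contour_integral (SOME \<gamma>. enclosing_contour f (set zs) \<gamma>) (\<lambda>z. f z / (\<Prod>w\<leftarrow>zs. z - w))"

definition exp_divided_difference :: "complex \<Rightarrow> complex list \<Rightarrow> complex" where
  "exp_divided_difference t zs = divided_difference (\<lambda>z. exp (t * z)) zs"

lemma prod_list_diff_eq_0_iff: "(\<Prod>w\<leftarrow>zs. z - w) = 0 \<longleftrightarrow> (z::complex) \<in> set zs"
  by (induction zs) auto

lemma enclosing_contour_residues:
  assumes "enclosing_contour f (set zs) \<gamma>"
  shows "contour_integral \<gamma> (\<lambda>z. f z / (\<Prod>w\<leftarrow>zs. z - w)) =
           2 * of_real pi * \<i> * (\<Sum>p\<in>set zs. residue (\<lambda>z. f z / (\<Prod>w\<leftarrow>zs. z - w)) p)"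
proof -
  let ?P = "path_image \<gamma>" and ?g = "\<lambda>z. f z / (\<Prod>w\<leftarrow>zs. z - w)"
  from assms obtain S where \<gamma>: "valid_path \<gamma>" "simple_path \<gamma>" "pathfinish \<gamma> = pathstart \<gamma>"
      "\<And>z. z \<in> inside ?P \<Longrightarrow> winding_number \<gamma> z = 1" "set zs \<subseteq> inside ?P"
      and S: "open S" "?P \<union> inside ?P \<subseteq> S" "f holomorphic_on S"
    unfolding enclosing_contour_def by blast
  define C where "C = connected_component_set S (pathstart \<gamma>)"
  have conn: "connected (?P \<union> inside ?P)"
    using \<gamma> by (intro connected_with_inside closed_path_image)
       (auto simp: simple_path_imp_path connected_simple_path_image)
  have sub: "?P \<union> inside ?P \<subseteq> C"
    unfolding C_def using S conn by (intro connected_component_maximal) auto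
  have "C \<subseteq> S" by (simp add: C_def connected_component_subset)
  have prod_hol: "(\<lambda>z. \<Prod>w\<leftarrow>ws. z - w) holomorphic_on A" for A and ws :: "complex list"
    by (induction ws) (auto intro!: holomorphic_intros)
  have "contour_integral \<gamma> ?g = 2 * pi * \<i> * (\<Sum>p\<in>set zs. winding_number \<gamma> p * residue ?g p)"
  proof (rule Residue_theorem)
    show "open C" unfolding C_def using S by (simp add: open_connected_component)
    show "connected C" by (simp add: C_def)
    show "?g holomorphic_on C - set zs"
      using S \<open>C \<subseteq> S\<close> prod_hol
      by (intro holomorphic_on_divide) (auto simp: prod_list_diff_eq_0_iff intro: holomorphic_on_subset)
    show "?P \<subseteq> C - set zs"
      using sub \<gamma>(5) inside_no_overlap[of ?P] by blast
    show "\<forall>z. z \<notin> C \<longrightarrow> winding_number \<gamma> z = 0"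
    proof (intro allI impI)
      fix z assume "z \<notin> C"
      hence "z \<in> outside ?P" using sub union_with_inside[of ?P] by auto
      thus "winding_number \<gamma> z = 0"
        using \<gamma> by (intro winding_number_zero_in_outside) (auto simp: valid_path_imp_path)
    qed
  qed (use \<gamma> in auto)
  also have "(\<Sum>p\<in>set zs. winding_number \<gamma> p * residue ?g p) = (\<Sum>p\<in>set zs. residue ?g p)"
    using \<gamma> by (intro sum.cong) auto
  finally show ?thesis by simp
qed

lemma divided_difference_eq:
  assumes "enclosing_contour f (set zs) \<gamma>"
  shows "divided_difference f zs =
           1 / (2 * of_real pi * \<i>) * contour_integral \<gamma> (\<lambda>z. f z / (\<Prod>w\<leftarrow>zs. z - w))"
proof -
  have "enclosing_contour f (set zs) (SOME \<gamma>. enclosing_contour f (set zs) \<gamma>)"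
    by (rule someI[of _ \<gamma>]) (rule assms)
  thus ?thesis
    using assms by (simp add: divided_difference_def enclosing_contour_residues)
qed

lemma enclosing_contour_circlepath:
  assumes "r > 0" "Z \<subseteq> ball c r" "f holomorphic_on UNIV"
  shows "enclosing_contour f Z (circlepath c r)"
proof -
  have inside: "inside (path_image (circlepath c r)) = ball c r"
    using assms inside_frontier_eq_interior[of "cball c r"] by (simp add: frontier_cball)
  have "open (UNIV :: complex set)" by simp
  then show ?thesis
    unfolding enclosing_contour_def inside using assms
    by (auto simp: simple_path_circlepath dist_norm norm_minus_commute intro!: winding_number_circlepath)
qed

lemma divided_difference_distinct:
  assumes "enclosing_contour f (set zs) \<gamma>" and "distinct zs"
  shows "divided_difference f zs = (\<Sum>p\<in>set zs. f p / (\<Prod>w\<in>set zs - {p}. p - w))"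
proof -
  have prod: "(\<Prod>w\<leftarrow>zs. z - w) = (\<Prod>w\<in>set zs. z - w)" for z
    using assms(2) by (simp add: prod.distinct_set_conv_list)
  have res: "residue (\<lambda>z. f z / (\<Prod>w\<in>set zs. z - w)) p = f p / (\<Prod>w\<in>set zs - {p}. p - w)"
    if p: "p \<in> set zs" for p
  proof -
    let ?h = "\<lambda>z. f z / (\<Prod>w\<in>set zs - {p}. z - w)"
    from assms(1) obtain S where S: "open S" "set zs \<subseteq> S" "f holomorphic_on S"
      unfolding enclosing_contour_def by blast
    let ?T = "S - (set zs - {p})"
    have "residue (\<lambda>z. ?h z / (z - p)) p = ?h p"
    proof (rule residue_simple)
      show "open ?T" using S by (simp add: finite_imp_closed open_Diff)
      show "p \<in> ?T" using S p by auto
      show "?h holomorphic_on ?T"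
        using S(3) by (intro holomorphic_intros) (auto intro: holomorphic_on_subset)
    qed
    moreover have "(\<lambda>z. f z / (\<Prod>w\<in>set zs. z - w)) = (\<lambda>z. ?h z / (z - p))"
      using p by (simp add: prod.remove[of _ p] mult.commute)
    ultimately show ?thesis by simp
  qed
  show ?thesis
    using res enclosing_contour_residues[OF assms(1)] divided_difference_eq[OF assms(1)] by (simp add: prod)
qed

end

theory Submission
  imports Defs
begin

text \<open>
  Let \<open>P\<close> be the nodal polynomial. By its logarithmic derivative, the derivative of \<open>f / P\<close> is
  \<open>f' / P\<close> minus the sum over the nodes \<open>w\<close> of \<open>f / (P \<cdot> (z - w))\<close>. The contour integral of the
  left-hand side vanishes, and the remaining integrals are divided differences.
\<close>

text \<open>Induction on the list with the product rule. Away from the nodes the derivative can be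
  written as the product times a sum of reciprocals, in which a repeated node contributes one term
  per occurrence.\<close>

lemma has_field_derivative_prod_list_diff:
  fixes z :: "'a::real_normed_field"
  assumes "z \<notin> set zs"
  shows "((\<lambda>z. \<Prod>w\<leftarrow>zs. z - w) has_field_derivative (\<Prod>w\<leftarrow>zs. z - w) * (\<Sum>w\<leftarrow>zs. 1 / (z - w))) (at z)"
  using assms
proof (induction zs)
  case Nil
  then show ?case by simp
next
  case (Cons a zs)
  have "((\<lambda>z. (z - a) * (\<Prod>w\<leftarrow>zs. z - w)) has_field_derivative
      1 * (\<Prod>w\<leftarrow>zs. z - w) + (\<Prod>w\<leftarrow>zs. z - w) * (\<Sum>w\<leftarrow>zs. 1 / (z - w)) * (z - a)) (at z)"
    using Cons by (intro DERIV_mult) (auto intro!: derivative_eq_intros)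
  then have "((\<lambda>z. (z - a) * (\<Prod>w\<leftarrow>zs. z - w)) has_field_derivative
      (\<Prod>w\<leftarrow>a # zs. z - w) * (\<Sum>w\<leftarrow>a # zs. 1 / (z - w))) (at z)"
    by (rule DERIV_cong) (use Cons.prems in \<open>simp add: distrib_left\<close>)
  then show ?case
    by simp
qed

text \<open>All nodes lie in the open ball, hence off the circle, so the integrand is continuous on
  the path.\<close>

lemma contour_integrable_on_circlepath_divided_difference:
  assumes "f holomorphic_on UNIV" "r > 0" "set zs \<subseteq> ball c r"
  shows "(\<lambda>z. f z / (\<Prod>w\<leftarrow>zs. z - w)) contour_integrable_on circlepath c r"
proof (rule contour_integrable_continuous_circlepath)
  have "continuous_on A (\<lambda>z. \<Prod>w\<leftarrow>zs. z - w)" for A :: "complex set"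
    by (induction zs) (auto intro!: continuous_intros)
  moreover have "continuous_on A f" for A
    using assms(1) holomorphic_on_imp_continuous_on continuous_on_subset by blast
  ultimately show "continuous_on (path_image (circlepath c r)) (\<lambda>z. f z / (\<Prod>w\<leftarrow>zs. z - w))"
    using assms by (intro continuous_on_divide) (auto simp: prod_list_diff_eq_0_iff)
qed

text \<open>Replaces the contour chosen by \<open>SOME\<close> by an explicit circle, so that
  several divided differences can be compared over one common path.\<close>

lemma divided_difference_circlepath:
  assumes "f holomorphic_on UNIV" "r > 0" "set zs \<subseteq> ball c r"
  shows "divided_difference f zs = 1 / (2 * of_real pi * \<i>) *
           contour_integral (circlepath c r) (\<lambda>z. f z / (\<Prod>w\<leftarrow>zs. z - w))"
  using assms by (intro divided_difference_eq enclosing_contour_circlepath)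

lemma divided_difference_cmult:
  assumes "f holomorphic_on UNIV"
  shows "divided_difference (\<lambda>z. k * f z) zs = k * divided_difference f zs"
proof -
  obtain r where r: "r > 0" "set zs \<subseteq> ball 0 r"
    using bounded_subset_ballD[OF finite_imp_bounded[OF finite_set]] by blast
  have "(\<lambda>z. k * f z) holomorphic_on UNIV"
    using assms by (intro holomorphic_intros)
  then show ?thesis
    using contour_integral_lmul[OF contour_integrable_on_circlepath_divided_difference[OF assms r], of k]
    by (simp add: divided_difference_circlepath[OF _ r] assms)
qed

text \<open>Distinctness is asked of the indices \<open>js\<close> only: nodes \<open>x j\<close>
  with different indices may coincide, and each index still gives its own summand.\<close>

lemma sum_divided_difference_repeat_node:
  fixes x :: "'i \<Rightarrow> complex"
  assumes "f holomorphic_on UNIV" "distinct js"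
  shows "(\<Sum>j\<in>set js. divided_difference f (map x js @ [x j])) = divided_difference (deriv f) (map x js)"
proof -
  let ?zs = "map x js"
  let ?P = "\<lambda>z. \<Prod>w\<leftarrow>?zs. z - w"
  let ?g = "\<lambda>j z. f z / (\<Prod>w\<leftarrow>?zs @ [x j]. z - w)"
  obtain r where r: "r > 0" "set ?zs \<subseteq> ball 0 r"
    using bounded_subset_ballD[OF finite_imp_bounded[OF finite_set]] by blast
  \<comment> \<open>Appending \<open>x j\<close> repeats a node already present, so one circle
    serves for every summand and for the right-hand side.\<close>
  have rj: "set (?zs @ [x j]) \<subseteq> ball 0 r" if "j \<in> set js" for j
    using r that by auto
  let ?C = "circlepath 0 r"
  have df: "deriv f holomorphic_on UNIV"
    using assms(1) by (intro holomorphic_deriv) auto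
  have int: "?g j contour_integrable_on ?C" if "j \<in> set js" for j
    using contour_integrable_on_circlepath_divided_difference[OF assms(1) r(1) rj[OF that]] .
  have int': "(\<lambda>z. deriv f z / ?P z) contour_integrable_on ?C"
    by (rule contour_integrable_on_circlepath_divided_difference[OF df r])
  \<comment> \<open>The integrand has the single-valued primitive \<open>f / P\<close> on the whole
    complement of the nodes, and the circle is closed. Hence the integral is zero although the
    circle winds around the poles.\<close>
  have "((\<lambda>z. deriv f z / ?P z - (\<Sum>j\<in>set js. ?g j z)) has_contour_integral 0) ?C"
  proof (rule Cauchy_theorem_primitive)
    fix z assume "z \<in> - set ?zs"
    then have z: "z \<notin> set ?zs" "?P z \<noteq> 0"
      using prod_list_diff_eq_0_iff[of z ?zs] by auto
    have "(f has_field_derivative deriv f z) (at z)"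
      using holomorphic_derivI[OF assms(1)] by simp
    from DERIV_divide[OF this has_field_derivative_prod_list_diff[OF z(1)] z(2)]
    have "((\<lambda>z. f z / ?P z) has_field_derivative
        deriv f z / ?P z - f z / ?P z * (\<Sum>w\<leftarrow>?zs. 1 / (z - w))) (at z)"
      by (rule DERIV_cong) (use z(2) in \<open>simp add: diff_divide_distrib right_diff_distrib left_diff_distrib\<close>)
    \<comment> \<open>Passing from nodes to indices keeps multiplicities, since \<open>js\<close>
      has no repetitions.\<close>
    also have "(\<Sum>w\<leftarrow>?zs. 1 / (z - w)) = (\<Sum>j\<in>set js. 1 / (z - x j))"
      using assms(2) by (simp add: sum.distinct_set_conv_list o_def)
    \<comment> \<open>Each factor \<open>1 / (z - x j)\<close> is absorbed into the denominator as
      the appended node.\<close>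
    also have "f z / ?P z * \<dots> = (\<Sum>j\<in>set js. ?g j z)"
      by (simp add: sum_distrib_left)
    finally show "((\<lambda>z. f z / ?P z) has_field_derivative
        deriv f z / ?P z - (\<Sum>j\<in>set js. ?g j z)) (at z within - set ?zs)"
      by (rule DERIV_subset) simp
  qed (use r in auto)
  then have "0 = contour_integral ?C (\<lambda>z. deriv f z / ?P z - (\<Sum>j\<in>set js. ?g j z))"
    by (simp add: contour_integral_unique)
  also have "\<dots> = contour_integral ?C (\<lambda>z. deriv f z / ?P z) - (\<Sum>j\<in>set js. contour_integral ?C (?g j))"
    using int int' by (simp only: contour_integral_diff contour_integrable_sum contour_integral_sum finite_set)
  finally have "(\<Sum>j\<in>set js. contour_integral ?C (?g j)) = contour_integral ?C (\<lambda>z. deriv f z / ?P z)"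
    by simp
  then show ?thesis
    by (simp only: divided_difference_circlepath[OF assms(1) r(1) rj] divided_difference_circlepath[OF df r]
        sum_distrib_left[symmetric] cong: sum.cong)
qed

theorem theorem6:
  fixes q :: nat and x :: "nat \<Rightarrow> complex" and \<tau> :: real
  shows "(\<Sum>j=0..q. exp_divided_difference (- complex_of_real \<tau>) (map x [0..<Suc q] @ [x j])) =
           - complex_of_real \<tau> * exp_divided_difference (- complex_of_real \<tau>) (map x [0..<Suc q])"
proof -
  let ?t = "- complex_of_real \<tau>"
  let ?f = "\<lambda>z. exp (?t * z)"
  have hol: "?f holomorphic_on UNIV"
    by (intro holomorphic_intros)
  \<comment> \<open>The exponential reproduces itself up to the constant \<open>?t\<close>, which
    \<open>divided_difference_cmult\<close> then pulls out.\<close>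
  have deriv: "deriv ?f = (\<lambda>z. ?t * ?f z)"
    by (rule ext, rule DERIV_imp_deriv) (auto intro!: derivative_eq_intros)
  have "{0..q} = set [0..<Suc q]"
    by auto
  then show ?thesis
    unfolding exp_divided_difference_def
    using sum_divided_difference_repeat_node[OF hol distinct_upt, of x 0 "Suc q"]
    by (simp only: deriv divided_difference_cmult[OF hol])
qed

end
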